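(* Let $(I,\ge)$ be a partially ordered set and let $(X_i,\star_i)_{i\in I}$ together with $\pi^i_j:X_i\to X_j$ for $i\ge j$ be an inverse system in the category of pointed metric spaces with base-point-preserving 1-Lipschitz maps as morphisms. Then $(X_\infty,\star_\infty)$, with the projections $\pi^\infty_i:X_\infty\to X_i$, is its inverse limit in this category. That is, for every pointed metric space $(Y,\ast)$ with base-point-preserving 1-Lipschitz maps $u_i:Y\to X_i$ ($i\in I$) satisfying $\pi^i_j\circ u_i=u_j$ for all $i\ge j$, there is a unique base-point-preserving 1-Lipschitz map $u:Y\to X_\infty$ such that $\pi^\infty_i\circ u=u_i$ for all $i\in I$.
   Context: Inverse system means: each $(X_i,d_i)$ is a metric space with base point $\star_i\in X_i$; for $i\ge j$ the map $\pi^i_j:X_i\to X_j$ is 1-Lipschitz with $\pi^i_j(\star_i)=\star_j$; $\pi^i_i$ is the identity of $X_i$; and $\pi^j_k\circ\pi^i_j=\pi^i_k$ for $i\ge j\ge k$. $X_\infty$ is the set of $(x_i)_{i\in I}\in\prod_{i\in I}X_i$ with $\pi^i_j(x_i)=x_j$ for all $i\ge j$ and $\sup_{i\in I}d_i(\star_i,x_i)<\infty$, with base point $\star_\infty=(\star_i)_{i\in I}$ and metric $d_\infty(x,y)=\sup_{i\in I}d_i(x_i,y_i)$; $\pi^\infty_i((x_j)_{j\in I})=x_i$. *)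

theory Defs
  imports "HOL-Analysis.Analysis"
begin

locale pointed_metric_space = Metric_space M d
  for M :: "'a set" and d :: "'a \<Rightarrow> 'a \<Rightarrow> real" +
  fixes p :: 'a
  assumes base_point: "p \<in> M"

text \<open>
  Morphisms are functions on the underlying type that are only constrained on the carrier, so
  two of them represent the same map if and only if they agree on the carrier of the source.
\<close>

definition pointed_short_map ::
    "'a set \<Rightarrow> ('a \<Rightarrow> 'a \<Rightarrow> real) \<Rightarrow> 'a \<Rightarrow> 'b set \<Rightarrow> ('b \<Rightarrow> 'b \<Rightarrow> real) \<Rightarrow> 'b \<Rightarrow> ('a \<Rightarrow> 'b) \<Rightarrow> bool"
  where "pointed_short_map M d p N e q f \<longleftrightarrow>
           f \<in> M \<rightarrow> N \<and> f p = q \<and> (\<forall>x\<in>M. \<forall>y\<in>M. e (f x) (f y) \<le> d x y)"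

text \<open>
  The order on the index set is the relation \<open>r\<close>, where \<open>(j, i) \<in> r\<close> stands for \<open>i \<ge> j\<close>. It is
  not assumed to be directed, and \<open>I\<close> may be empty. The spaces are subsets \<open>X i\<close> of one common
  type \<open>'a\<close> and \<open>pr i j\<close> is the map from \<open>X i\<close> to \<open>X j\<close>.
\<close>

locale inverse_system =
  fixes I :: "'i set" and r :: "'i rel"
    and X :: "'i \<Rightarrow> 'a set" and d :: "'i \<Rightarrow> 'a \<Rightarrow> 'a \<Rightarrow> real" and p :: "'i \<Rightarrow> 'a"
    and pr :: "'i \<Rightarrow> 'i \<Rightarrow> 'a \<Rightarrow> 'a"
  assumes order: "partial_order_on I r"
    and spaces: "\<And>i. i \<in> I \<Longrightarrow> pointed_metric_space (X i) (d i) (p i)"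
    and maps: "\<And>i j. (j, i) \<in> r \<Longrightarrow>
      pointed_short_map (X i) (d i) (p i) (X j) (d j) (p j) (pr i j)"
    and identity: "\<And>i x. i \<in> I \<Longrightarrow> x \<in> X i \<Longrightarrow> pr i i x = x"
    and compose: "\<And>i j k x. (j, i) \<in> r \<Longrightarrow> (k, j) \<in> r \<Longrightarrow> x \<in> X i \<Longrightarrow>
      pr j k (pr i j x) = pr i k x"

text \<open>
  Suprema of distances are taken in \<open>[0, \<infinity>]\<close>, so the supremum over an empty index set is \<open>0\<close>.
  On \<open>limit_space\<close> the supremum in \<open>limit_dist\<close> is finite; outside, \<open>enn2real\<close> sends the
  value \<open>\<infinity>\<close> to \<open>0\<close>.
\<close>

definition limit_base :: "'i set \<Rightarrow> ('i \<Rightarrow> 'a) \<Rightarrow> 'i \<Rightarrow> 'a"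
  where "limit_base I p = restrict p I"

definition limit_space ::
    "'i set \<Rightarrow> 'i rel \<Rightarrow> ('i \<Rightarrow> 'a set) \<Rightarrow> ('i \<Rightarrow> 'a \<Rightarrow> 'a \<Rightarrow> real) \<Rightarrow> ('i \<Rightarrow> 'a) \<Rightarrow>
     ('i \<Rightarrow> 'i \<Rightarrow> 'a \<Rightarrow> 'a) \<Rightarrow> ('i \<Rightarrow> 'a) set"
  where "limit_space I r X d p pr =
           {x \<in> Pi\<^sub>E I X. (\<forall>i j. (j, i) \<in> r \<longrightarrow> pr i j (x i) = x j) \<and>
                      (SUP i\<in>I. ennreal (d i (p i) (x i))) < \<infinity>}"

definition limit_dist ::
    "'i set \<Rightarrow> ('i \<Rightarrow> 'a \<Rightarrow> 'a \<Rightarrow> real) \<Rightarrow> ('i \<Rightarrow> 'a) \<Rightarrow> ('i \<Rightarrow> 'a) \<Rightarrow> real"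
  where "limit_dist I d x y = enn2real (SUP i\<in>I. ennreal (d i (x i) (y i)))"

definition limit_proj :: "'i \<Rightarrow> ('i \<Rightarrow> 'a) \<Rightarrow> 'a"
  where "limit_proj i x = x i"

end

theory Submission
  imports Defs
begin

text \<open>
  The category has short maps as morphisms, so the distance of a limit must dominate every
  \<open>d i\<close>, and the supremum is the smallest such distance. It is also characterised by its upper
  bounds: for \<open>c \<ge> 0\<close>, \<open>d_inf x y \<le> c\<close> holds iff \<open>d i (x i) (y i) \<le> c\<close> for all \<open>i\<close>. One direction
  (\<open>coordinate_dist_le\<close>) makes the projections short, the other (\<open>limit_dist_le\<close>) makes a map
  into the limit short as soon as its coordinates are. The metric axioms follow from those of
  the \<open>X i\<close> by the same two facts.

  Restricting to the threads at finite distance from the base point is what makes the supremum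
  finite, and it costs nothing in the universal property. Given a compatible cone of pointed
  short maps \<open>u i\<close> from \<open>Y\<close>, the only candidate sends \<open>y\<close> to the thread of the values
  \<open>u i y\<close>. Since \<open>u i q = p i\<close>, this thread lies within \<open>dY q y\<close> of the base point in every
  coordinate, so it belongs to the limit; here preservation of base points and shortness are
  used together.
\<close>

lemma bounded_SUP_ennreal:
  fixes f :: "'i \<Rightarrow> real"
  assumes "\<And>i. i \<in> I \<Longrightarrow> f i \<le> c"
  shows "(SUP i\<in>I. ennreal (f i)) \<le> ennreal c"
  using assms by (intro SUP_least ennreal_leI)

context inverse_system
begin

lemma metric: "i \<in> I \<Longrightarrow> Metric_space (X i) (d i)"
  using spaces unfolding pointed_metric_space_def by blast

lemma base_in: "i \<in> I \<Longrightarrow> p i \<in> X i"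
  using spaces pointed_metric_space.base_point by metis

lemma coordinate_triangle:
  assumes "i \<in> I" "x \<in> X i" "y \<in> X i" "z \<in> X i"
  shows "d i x z \<le> d i x y + d i y z"
  using Metric_space.triangle[OF metric] assms by metis

lemma coordinate_commute: "i \<in> I \<Longrightarrow> d i x y = d i y x"
  using Metric_space.commute[OF metric] by metis

lemma index_in: "(j, i) \<in> r \<Longrightarrow> i \<in> I \<and> j \<in> I"
  using order unfolding partial_order_on_def preorder_on_def by blast

abbreviation "X_lim \<equiv> limit_space I r X d p pr"
abbreviation "d_lim \<equiv> limit_dist I d"
abbreviation "p_lim \<equiv> limit_base I p"

lemma limit_space_coord: "x \<in> X_lim \<Longrightarrow> i \<in> I \<Longrightarrow> x i \<in> X i"
  unfolding limit_space_def by auto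

lemma limit_spaceI:
  assumes "x \<in> Pi\<^sub>E I X"
    and "\<And>i j. (j, i) \<in> r \<Longrightarrow> pr i j (x i) = x j"
    and "\<And>i. i \<in> I \<Longrightarrow> d i (p i) (x i) \<le> c"
  shows "x \<in> X_lim"
proof -
  have "(SUP i\<in>I. ennreal (d i (p i) (x i))) \<le> ennreal c"
    using assms(3) by (rule bounded_SUP_ennreal)
  also have "\<dots> < \<infinity>"
    by simp
  finally show ?thesis
    using assms(1,2) unfolding limit_space_def by blast
qed

lemma limit_space_bounded:
  assumes "x \<in> X_lim"
  obtains c where "\<And>i. i \<in> I \<Longrightarrow> d i (p i) (x i) \<le> c"
proof
  fix i assume i: "i \<in> I"
  let ?S = "SUP i\<in>I. ennreal (d i (p i) (x i))"
  have fin: "?S < top"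
    using assms unfolding limit_space_def by simp
  have "ennreal (d i (p i) (x i)) \<le> ?S"
    using i by (rule SUP_upper)
  with fin show "d i (p i) (x i) \<le> enn2real ?S"
    using enn2real_mono Metric_space.nonneg[OF metric[OF i]] by fastforce
qed

text \<open>
  Nonnegativity of the bound matters only for empty \<open>I\<close>, where the distance is the empty
  supremum \<open>0\<close>.
\<close>

lemma limit_dist_le:
  assumes "0 \<le> c" and "\<And>i. i \<in> I \<Longrightarrow> d i (x i) (y i) \<le> c"
  shows "d_lim x y \<le> c"
  unfolding limit_dist_def
  using bounded_SUP_ennreal[OF assms(2)] assms(1) by (rule enn2real_leI[rotated])

text \<open>
  The supremum is finite because the distance from \<open>x i\<close> to \<open>y i\<close> is at most the sum of their
  distances to \<open>p i\<close>, which are bounded uniformly in \<open>i\<close>. Without this, \<open>enn2real\<close> would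
  collapse an infinite supremum to \<open>0\<close> and the estimate could fail.
\<close>

lemma coordinate_dist_le:
  assumes x: "x \<in> X_lim" and y: "y \<in> X_lim" and i: "i \<in> I"
  shows "d i (x i) (y i) \<le> d_lim x y"
proof -
  let ?S = "SUP i\<in>I. ennreal (d i (x i) (y i))"
  obtain a where a: "\<And>i. i \<in> I \<Longrightarrow> d i (p i) (x i) \<le> a"
    using limit_space_bounded[OF x] by blast
  obtain b where b: "\<And>i. i \<in> I \<Longrightarrow> d i (p i) (y i) \<le> b"
    using limit_space_bounded[OF y] by blast
  have "d k (x k) (y k) \<le> a + b" if k: "k \<in> I" for k
    using coordinate_triangle[OF k limit_space_coord[OF x k] base_in[OF k] limit_space_coord[OF y k]]
      coordinate_commute[OF k, of "x k"] a[OF k] b[OF k] by simp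
  then have "?S \<le> ennreal (a + b)"
    by (rule bounded_SUP_ennreal)
  also have "\<dots> < top"
    by simp
  finally have fin: "?S < top" .
  have "ennreal (d i (x i) (y i)) \<le> ?S"
    using i by (rule SUP_upper)
  with fin show ?thesis
    unfolding limit_dist_def
    using enn2real_mono Metric_space.nonneg[OF metric[OF i]] by fastforce
qed

lemma limit_dist_nonneg: "0 \<le> d_lim x y"
  unfolding limit_dist_def by simp

lemma limit_dist_commute: "d_lim x y = d_lim y x"
  unfolding limit_dist_def using coordinate_commute by (metis (mono_tags, lifting) SUP_cong)

lemma limit_dist_eq_0:
  assumes x: "x \<in> X_lim" and y: "y \<in> X_lim"
  shows "d_lim x y = 0 \<longleftrightarrow> x = y"
proof
  assume 0: "d_lim x y = 0"
  have "x i = y i" if i: "i \<in> I" for i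
    using coordinate_dist_le[OF x y i] 0 Metric_space.nonneg[OF metric[OF i], of "x i" "y i"]
      Metric_space.zero[OF metric[OF i] limit_space_coord[OF x i] limit_space_coord[OF y i]]
    by simp
  moreover have "x \<in> extensional I" "y \<in> extensional I"
    using x y unfolding limit_space_def by (auto simp: PiE_def)
  ultimately show "x = y"
    by (metis extensionalityI)
next
  assume "x = y"
  moreover have "d i (x i) (x i) \<le> 0" if i: "i \<in> I" for i
    using Metric_space.mdist_zero[OF metric[OF i] limit_space_coord[OF x i]] by simp
  ultimately show "d_lim x y = 0"
    using limit_dist_le[of 0 x x] limit_dist_nonneg[of x x] by simp
qed

lemma limit_dist_triangle:
  assumes x: "x \<in> X_lim" and y: "y \<in> X_lim" and z: "z \<in> X_lim"
  shows "d_lim x z \<le> d_lim x y + d_lim y z"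
proof (rule limit_dist_le)
  show "0 \<le> d_lim x y + d_lim y z"
    using limit_dist_nonneg by simp
next
  fix i assume i: "i \<in> I"
  show "d i (x i) (z i) \<le> d_lim x y + d_lim y z"
    using coordinate_triangle[OF i] limit_space_coord[OF _ i] x y z
      coordinate_dist_le[OF x y i] coordinate_dist_le[OF y z i] by fastforce
qed

lemma limit_base_in: "p_lim \<in> X_lim"
proof (rule limit_spaceI)
  show "p_lim \<in> Pi\<^sub>E I X"
    using base_in unfolding limit_base_def by auto
  show "pr i j (p_lim i) = p_lim j" if "(j, i) \<in> r" for i j
    using maps[OF that] index_in[OF that] unfolding limit_base_def pointed_short_map_def by simp
  show "d i (p i) (p_lim i) \<le> 0" if "i \<in> I" for i
    using that Metric_space.mdist_zero[OF metric base_in] unfolding limit_base_def by simp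
qed

lemma pointed_metric_space_limit: "pointed_metric_space X_lim d_lim p_lim"
proof (unfold_locales)
  show "0 \<le> d_lim x y" for x y
    by (rule limit_dist_nonneg)
  show "d_lim x y = d_lim y x" for x y
    by (rule limit_dist_commute)
qed (simp_all add: limit_dist_eq_0 limit_dist_triangle limit_base_in)

lemma limit_proj_short:
  assumes i: "i \<in> I"
  shows "pointed_short_map X_lim d_lim p_lim (X i) (d i) (p i) (limit_proj i)"
  using i limit_space_coord coordinate_dist_le
  unfolding pointed_short_map_def limit_proj_def by (auto simp: limit_base_def)

lemma limit_proj_compatible:
  assumes "(j, i) \<in> r" and "x \<in> X_lim"
  shows "pr i j (limit_proj i x) = limit_proj j x"
  using assms unfolding limit_proj_def limit_space_def by blast

text \<open>
  The mediating map is cut off outside \<open>Y\<close>, and the threads outside \<open>I\<close>: only the values on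
  the carriers are determined by the cone.
\<close>

lemma limit_universal:
  fixes Y :: "'y set" and u :: "'i \<Rightarrow> 'y \<Rightarrow> 'a"
  assumes Y: "pointed_metric_space Y dY q"
    and u: "\<And>i. i \<in> I \<Longrightarrow> pointed_short_map Y dY q (X i) (d i) (p i) (u i)"
    and compatible: "\<And>i j y. (j, i) \<in> r \<Longrightarrow> y \<in> Y \<Longrightarrow> pr i j (u i y) = u j y"
  shows "\<exists>!v. v \<in> extensional Y \<and> pointed_short_map Y dY q X_lim d_lim p_lim v \<and>
           (\<forall>i\<in>I. \<forall>y\<in>Y. limit_proj i (v y) = u i y)"
proof (rule ex1I)
  interpret Y: pointed_metric_space Y dY q
    by (rule Y)
  define v where "v = (\<lambda>y\<in>Y. \<lambda>i\<in>I. u i y)"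
  have in_X: "u i y \<in> X i" and base: "u i q = p i" if "i \<in> I" "y \<in> Y" for i y
    using u[OF that(1)] that(2) unfolding pointed_short_map_def by auto
  have short: "d i (u i y) (u i z) \<le> dY y z" if "i \<in> I" "y \<in> Y" "z \<in> Y" for i y z
    using u[OF that(1)] that(2,3) unfolding pointed_short_map_def by blast
  have v_in: "v y \<in> X_lim" if y: "y \<in> Y" for y
  proof (rule limit_spaceI)
    show "v y \<in> Pi\<^sub>E I X"
      using y in_X by (auto simp: v_def)
    show "pr i j (v y i) = v y j" if "(j, i) \<in> r" for i j
      using index_in[OF that] compatible[OF that y] y by (simp add: v_def)
    show "d i (p i) (v y i) \<le> dY q y" if i: "i \<in> I" for i
      using short[OF i Y.base_point y] base[OF i y] i y by (simp add: v_def)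
  qed
  have "d_lim (v y) (v z) \<le> dY y z" if "y \<in> Y" "z \<in> Y" for y z
    by (rule limit_dist_le) (use short that in \<open>simp_all add: v_def\<close>)
  moreover have "v q = p_lim"
    using base[OF _ Y.base_point] Y.base_point
    by (auto simp: v_def limit_base_def intro: restrict_ext)
  ultimately have "pointed_short_map Y dY q X_lim d_lim p_lim v"
    using v_in unfolding pointed_short_map_def by blast
  then show "v \<in> extensional Y \<and> pointed_short_map Y dY q X_lim d_lim p_lim v \<and>
      (\<forall>i\<in>I. \<forall>y\<in>Y. limit_proj i (v y) = u i y)"
    by (simp add: v_def limit_proj_def)

  fix w
  assume w: "w \<in> extensional Y \<and> pointed_short_map Y dY q X_lim d_lim p_lim w \<and>
      (\<forall>i\<in>I. \<forall>y\<in>Y. limit_proj i (w y) = u i y)"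
  show "w = v"
  proof (rule extensionalityI)
    show "w \<in> extensional Y"
      using w by blast
    show "v \<in> extensional Y"
      by (simp add: v_def)
    show "w y = v y" if y: "y \<in> Y" for y
    proof (rule extensionalityI)
      have "w y \<in> X_lim"
        using w y unfolding pointed_short_map_def by blast
      then show "w y \<in> extensional I"
        unfolding limit_space_def by (simp add: PiE_def)
      show "v y \<in> extensional I"
        using y by (simp add: v_def)
      show "w y i = v y i" if "i \<in> I" for i
        using w y that by (simp add: v_def limit_proj_def)
    qed
  qed
qed

end

theorem lemma2p3:
  fixes I :: "'i set" and r :: "'i rel"
    and X :: "'i \<Rightarrow> 'a set" and d :: "'i \<Rightarrow> 'a \<Rightarrow> 'a \<Rightarrow> real" and p :: "'i \<Rightarrow> 'a"
    and pr :: "'i \<Rightarrow> 'i \<Rightarrow> 'a \<Rightarrow> 'a"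
  assumes "inverse_system I r X d p pr"
  defines "X_inf \<equiv> limit_space I r X d p pr"
    and "d_inf \<equiv> limit_dist I d"
    and "p_inf \<equiv> limit_base I p"
  shows "pointed_metric_space X_inf d_inf p_inf \<and>
    (\<forall>i\<in>I. pointed_short_map X_inf d_inf p_inf (X i) (d i) (p i) (limit_proj i)) \<and>
    (\<forall>i j. (j, i) \<in> r \<longrightarrow> (\<forall>x\<in>X_inf. pr i j (limit_proj i x) = limit_proj j x)) \<and>
    (\<forall>(Y :: 'y set) dY q (u :: 'i \<Rightarrow> 'y \<Rightarrow> 'a).
       pointed_metric_space Y dY q \<and>
       (\<forall>i\<in>I. pointed_short_map Y dY q (X i) (d i) (p i) (u i)) \<and>
       (\<forall>i j. (j, i) \<in> r \<longrightarrow> (\<forall>y\<in>Y. pr i j (u i y) = u j y)) \<longrightarrow>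
       (\<exists>!v. v \<in> extensional Y \<and>
         pointed_short_map Y dY q X_inf d_inf p_inf v \<and>
         (\<forall>i\<in>I. \<forall>y\<in>Y. limit_proj i (v y) = u i y)))"
proof -
  interpret inverse_system I r X d p pr
    by (rule assms(1))
  show ?thesis
    unfolding X_inf_def d_inf_def p_inf_def
    using pointed_metric_space_limit limit_proj_short limit_proj_compatible
    by (intro conjI allI impI ballI limit_universal) auto
qed

end
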